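(* Let $X$ be a finite set and $C(X)$ the algebra of all complex-valued functions on $X$. The evaluation map $\mathcal{E} : \mathrm{Sym}^n(X) \to \mathrm{Hom}(C(X),\mathbb{C})$, $[x_1,\dots,x_n] \mapsto \big(g \mapsto \sum_{r=1}^n g(x_r)\big)$, is a bijection from $\mathrm{Sym}^n(X)$ onto the set of Frobenius $n$-homomorphisms $C(X)\to\mathbb{C}$.
   Context: $\mathrm{Sym}^n(X) = X^n/\Sigma_n$ is the set of unordered $n$-tuples (multisets of size $n$) of elements of $X$; $\mathrm{Hom}(C(X),\mathbb{C})$ is the space of $\mathbb{C}$-linear maps. For a $\mathbb{C}$-linear map $f : C(X) \to \mathbb{C}$ and $k \ge 1$, define $\Phi_k(f)(a_1,\dots,a_k) = \sum_{\sigma \in \Sigma_k} \epsilon(\sigma) f_\sigma(a_1,\dots,a_k)$, where $\epsilon(\sigma)$ is the sign, and if $\sigma = \gamma_1\cdots\gamma_q$ is the disjoint cycle decomposition (including cycles of length one) then $f_\sigma = \prod_j f_{\gamma_j}$ with $f_\gamma(a_1,\dots,a_k) = f(a_{r_1}\cdots a_{r_j})$ for $\gamma = (r_1\,\dots\,r_j)$. A $\mathbb{C}$-linear map $f$ is a Frobenius $n$-homomorphism if $\Phi_{n+1}(f)$ vanishes identically and $f(1) = n$. *)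

theory Defs
  imports Complex_Main "HOL-Library.FuncSet" "HOL-Library.Multiset" 
    "HOL-Combinatorics.Permutations" "HOL-Combinatorics.Orbits"
begin

text \<open>A function on the carrier \<open>X\<close> is a HOL function that is \<open>extensional\<close> on \<open>X\<close>, so that
  equality in \<open>CX X\<close> is equality of values on \<open>X\<close>. The algebra operations are pointwise, hence
  the restrictions to \<open>X\<close> below. The empty set \<open>X\<close> is allowed.\<close>

definition CX :: "'a set \<Rightarrow> ('a \<Rightarrow> complex) set" where
  "CX X = X \<rightarrow>\<^sub>E UNIV"

text \<open>Likewise, functionals are made extensional on \<open>CX X\<close>.\<close>

definition Hom_CX :: "'a set \<Rightarrow> (('a \<Rightarrow> complex) \<Rightarrow> complex) set" where
  "Hom_CX X = {f \<in> extensional (CX X).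
     (\<forall>g\<in>CX X. \<forall>h\<in>CX X. f (\<lambda>x\<in>X. g x + h x) = f g + f h) \<and>
     (\<forall>c. \<forall>g\<in>CX X. f (\<lambda>x\<in>X. c * g x) = c * f g)}"

text \<open>The cycles of \<open>\<sigma>\<close>, those of length one included, are given by its orbits on \<open>{1..k}\<close>; the
  cyclic order inside a cycle is irrelevant because multiplication in \<open>CX X\<close> is commutative.\<close>

definition f_perm ::
  "'a set \<Rightarrow> (('a \<Rightarrow> complex) \<Rightarrow> complex) \<Rightarrow> nat \<Rightarrow> (nat \<Rightarrow> nat) \<Rightarrow> (nat \<Rightarrow> 'a \<Rightarrow> complex) \<Rightarrow> complex"
  where
  "f_perm X f k \<sigma> a = (\<Prod>\<gamma> \<in> orbit \<sigma> ` {1..k}. f (\<lambda>x\<in>X. \<Prod>r\<in>\<gamma>. a r x))"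

definition Phi ::
  "'a set \<Rightarrow> nat \<Rightarrow> (('a \<Rightarrow> complex) \<Rightarrow> complex) \<Rightarrow> (nat \<Rightarrow> 'a \<Rightarrow> complex) \<Rightarrow> complex" where
  "Phi X k f a = (\<Sum>\<sigma> | \<sigma> permutes {1..k}. of_int (sign \<sigma>) * f_perm X f k \<sigma> a)"

definition frobenius_hom :: "'a set \<Rightarrow> nat \<Rightarrow> (('a \<Rightarrow> complex) \<Rightarrow> complex) \<Rightarrow> bool" where
  "frobenius_hom X n f \<longleftrightarrow>
     f \<in> Hom_CX X \<and>
     (\<forall>a \<in> {1..n + 1} \<rightarrow> CX X. Phi X (n + 1) f a = 0) \<and>
     f (\<lambda>x\<in>X. 1) = of_nat n"

definition Sym :: "nat \<Rightarrow> 'a set \<Rightarrow> 'a multiset set" where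
  "Sym n X = {M. set_mset M \<subseteq> X \<and> size M = n}"

definition eval_map :: "'a set \<Rightarrow> 'a multiset \<Rightarrow> ('a \<Rightarrow> complex) \<Rightarrow> complex" where
  "eval_map X M = (\<lambda>g\<in>CX X. \<Sum>x\<in>#M. g x)"

end

theory Submission
  imports Defs "HOL-Computational_Algebra.Polynomial"
begin

text \<open>A sum of \<open>N\<close> evaluations turns \<open>\<Phi>\<^sub>k\<close> into a sum over maps \<open>\<phi>: {1..k} \<rightarrow> {..<N}\<close> of a weight
  times the sum of the signs of the permutations that preserve \<open>\<phi>\<close>. If \<open>N < k\<close>, then \<open>\<phi>\<close> identifies
  two points, and composing with their transposition shows that the signs cancel. Conversely, on the
  constant tuple of indicators of a point \<open>x\<close>, \<open>\<Phi>\<^bsub>n+1\<^esub>(f)\<close> is the value at \<open>f(\<delta>\<^sub>x)\<close> of the monic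
  polynomial \<open>P(z) = \<Sum>\<^sub>\<sigma> \<epsilon>(\<sigma>) z\<^bsup>cyc \<sigma>\<^esup>\<close> of degree \<open>n + 1\<close>. By the first part, applied to
  \<open>N\<close> copies of one point, \<open>P\<close> vanishes at \<open>N = 0, \<dots>, n\<close>, and so these are its only roots: every
  \<open>f(\<delta>\<^sub>x)\<close> is a natural number, and \<open>f(1) = n\<close> says that these multiplicities add up to \<open>n\<close>.\<close>

section \<open>Orbit expansions and cancellation of signs\<close>

lemma mem_orbit_iff:
  assumes "permutation p"
  shows "r \<in> orbit p s \<longleftrightarrow> orbit p r = orbit p s"
  using permutation_self_in_orbit[OF assms] orbit_swap[of s p r] by (blast intro: orbit_trans)

lemma invariant_on_orbit:
  assumes "p permutes S" "finite S" "\<And>r. r \<in> S \<Longrightarrow> \<phi> (p r) = \<phi> r" "s \<in> S" "r \<in> orbit p s"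
  shows "\<phi> r = \<phi> s"
  using assms(5)
proof induction
  case base
  show ?case using assms by simp
next
  case (step y)
  have "y \<in> S" using permutes_orbit_subset[OF assms(1,4)] step by blast
  then show ?case using assms step by simp
qed

text \<open>Expanding the product chooses one index per orbit, and such a choice is the same thing
  as a \<open>p\<close>-invariant map on \<open>S\<close>.\<close>

lemma prod_orbits_sum:
  fixes c :: "nat \<Rightarrow> 'b \<Rightarrow> complex"
  assumes p: "p permutes S" and S: "finite S" and I: "finite I"
  shows "(\<Prod>\<gamma>\<in>orbit p ` S. \<Sum>i\<in>I. \<Prod>r\<in>\<gamma>. c r i)
    = (\<Sum>\<phi> | \<phi> \<in> S \<rightarrow>\<^sub>E I \<and> (\<forall>r\<in>S. \<phi> (p r) = \<phi> r). \<Prod>r\<in>S. c r (\<phi> r))"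
proof -
  have pp: "permutation p" using p S by (rule permutes_imp_permutation[rotated])
  let ?O = "orbit p ` S" and ?R = "{\<phi> \<in> S \<rightarrow>\<^sub>E I. \<forall>r\<in>S. \<phi> (p r) = \<phi> r}"
  define F where "F \<psi> = (\<lambda>r\<in>S. \<psi> (orbit p r))" for \<psi> :: "nat set \<Rightarrow> 'b"
  \<comment> \<open>An invariant map is constant on each orbit, so \<open>SOME\<close> may pick any
    representative.\<close>
  define G where "G \<phi> = (\<lambda>\<gamma>\<in>?O. \<phi> (SOME r. r \<in> \<gamma>))" for \<phi> :: "nat \<Rightarrow> 'b"
  have some: "(SOME r. r \<in> orbit p s) \<in> orbit p s" for s
    using permutation_self_in_orbit[OF pp] by (rule someI)
  have orb: "orbit p s \<subseteq> S" if "s \<in> S" for s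
    using permutes_orbit_subset[OF p that] .
  \<comment> \<open>The fibres of \<open>orbit p\<close> on \<open>S\<close> are the orbits
    themselves; this regroups the double product as one product over \<open>S\<close>.\<close>
  have fib: "{r \<in> S. orbit p r = \<gamma>} = \<gamma>" if "\<gamma> \<in> ?O" for \<gamma>
    using that orb mem_orbit_iff[OF pp] by auto
  have "(\<Prod>\<gamma>\<in>?O. \<Sum>i\<in>I. \<Prod>r\<in>\<gamma>. c r i) = (\<Sum>\<psi>\<in>?O \<rightarrow>\<^sub>E I. \<Prod>\<gamma>\<in>?O. \<Prod>r\<in>\<gamma>. c r (\<psi> \<gamma>))"
    using S I by (intro prod_sum_PiE) auto
  also have "\<dots> = (\<Sum>\<psi>\<in>?O \<rightarrow>\<^sub>E I. \<Prod>r\<in>S. c r (\<psi> (orbit p r)))"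
  proof (rule sum.cong[OF refl])
    fix \<psi>
    have "(\<Prod>\<gamma>\<in>?O. \<Prod>r\<in>\<gamma>. c r (\<psi> \<gamma>)) = (\<Prod>\<gamma>\<in>?O. \<Prod>r | r \<in> S \<and> orbit p r = \<gamma>. c r (\<psi> (orbit p r)))"
    proof (rule prod.cong[OF refl])
      fix \<gamma> assume "\<gamma> \<in> ?O"
      from fib[OF this] show "(\<Prod>r\<in>\<gamma>. c r (\<psi> \<gamma>)) = (\<Prod>r | r \<in> S \<and> orbit p r = \<gamma>. c r (\<psi> (orbit p r)))"
        by (intro prod.cong) auto
    qed
    also have "\<dots> = (\<Prod>r\<in>S. c r (\<psi> (orbit p r)))"
      using S by (intro prod.group) auto
    finally show "(\<Prod>\<gamma>\<in>?O. \<Prod>r\<in>\<gamma>. c r (\<psi> \<gamma>)) = (\<Prod>r\<in>S. c r (\<psi> (orbit p r)))" .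
  qed
  also have "\<dots> = (\<Sum>\<phi>\<in>?R. \<Prod>r\<in>S. c r (\<phi> r))"
  proof (rule sum.reindex_bij_witness[where i = G and j = F])
    fix \<psi> assume \<psi>: "\<psi> \<in> ?O \<rightarrow>\<^sub>E I"
    have "F \<psi> (SOME r. r \<in> orbit p s) = \<psi> (orbit p s)" if "s \<in> S" for s
      using some[of s] orb[OF that] mem_orbit_iff[OF pp] by (auto simp: F_def)
    then show "G (F \<psi>) = \<psi>"
      using \<psi> by (intro extensionalityI[of _ ?O]) (auto simp: G_def PiE_iff)
    show "F \<psi> \<in> ?R"
      using \<psi> p by (auto simp: F_def permutes_in_image permutation_orbit_step[OF pp])
    show "(\<Prod>r\<in>S. c r (F \<psi> r)) = (\<Prod>r\<in>S. c r (\<psi> (orbit p r)))"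
      by (simp add: F_def)
  next
    fix \<phi> assume \<phi>: "\<phi> \<in> ?R"
    have *: "\<phi> (SOME r. r \<in> orbit p s) = \<phi> s" if "s \<in> S" for s
      using \<phi> by (intro invariant_on_orbit[OF p S _ that some]) simp
    show "F (G \<phi>) = \<phi>"
      using \<phi> by (intro extensionalityI[of _ S]) (auto simp: F_def G_def * PiE_iff)
    show "G \<phi> \<in> ?O \<rightarrow>\<^sub>E I"
      using \<phi> by (auto simp: G_def *)
  qed
  finally show ?thesis by simp
qed

text \<open>Composition with the transposition of \<open>i\<close> and \<open>j\<close> is a
  sign-reversing involution of the stabilizer of \<open>\<phi>\<close>, so the sum equals its own
  negative.\<close>

lemma sum_sign_stabilizer:
  assumes S: "finite S" and ij: "i \<in> S" "j \<in> S" "i \<noteq> j" "\<phi> i = \<phi> j"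
  shows "(\<Sum>p | p permutes S \<and> (\<forall>r\<in>S. \<phi> (p r) = \<phi> r). of_int (sign p)) = (0 :: complex)"
    (is "sum ?s ?A = 0")
proof -
  let ?t = "transpose i j"
  have t: "?t permutes S" using ij by (intro permutes_swap_id)
  have inv: "\<phi> (?t r) = \<phi> r" for r
    using ij by (simp add: transpose_def)
  have A: "?t \<circ> p \<in> ?A" if "p \<in> ?A" for p
    using that t inv by (auto intro: permutes_compose)
  have "sum ?s ?A = (\<Sum>p\<in>?A. - ?s p)"
  proof (rule sum.reindex_bij_witness[where i = "\<lambda>p. ?t \<circ> p" and j = "\<lambda>p. ?t \<circ> p"])
    fix p assume p: "p \<in> ?A"
    show "- ?s (?t \<circ> p) = ?s p"
      using p t ij(3) S by (simp add: sign_compose permutes_imp_permutation sign_swap_id)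
  qed (use A in \<open>simp_all flip: comp_assoc\<close>)
  then show ?thesis by (simp add: sum_negf)
qed

section \<open>Vanishing of \<open>Phi\<close> on sums of evaluations\<close>

lemma eval_map_mset:
  assumes "g \<in> CX X"
  shows "eval_map X (mset xs) g = (\<Sum>i<length xs. g (xs ! i))"
  using assms
  by (simp add: eval_map_def sum_mset_sum_list sum_list_sum_nth atLeast0LessThan flip: mset_map)

lemma restrict_in_CX [simp]: "restrict g X \<in> CX X"
  by (simp add: CX_def)

lemma Phi_eval_map_eq_0:
  assumes M: "set_mset M \<subseteq> X" "size M < k"
  shows "Phi X k (eval_map X M) a = 0"
proof -
  obtain xs where xs: "M = mset xs" using ex_mset by metis
  let ?S = "{1..k}" and ?I = "{..<length xs}"
  let ?W = "\<lambda>\<phi>. \<Prod>r\<in>?S. a r (xs ! \<phi> r)"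
  have X: "xs ! i \<in> X" if "i < length xs" for i
    using M xs that by auto
  have f: "f_perm X (eval_map X M) k p a
      = (\<Sum>\<phi> | \<phi> \<in> ?S \<rightarrow>\<^sub>E ?I \<and> (\<forall>r\<in>?S. \<phi> (p r) = \<phi> r). ?W \<phi>)" if "p permutes ?S" for p
    using prod_orbits_sum[OF that, of ?I "\<lambda>r i. a r (xs ! i)"] X
    by (simp add: f_perm_def xs eval_map_mset)
  have fin: "finite (?S \<rightarrow>\<^sub>E ?I)" by (intro finite_PiE) auto
  have "Phi X k (eval_map X M) a
      = (\<Sum>p | p permutes ?S. \<Sum>\<phi> | \<phi> \<in> ?S \<rightarrow>\<^sub>E ?I \<and> (\<forall>r\<in>?S. \<phi> (p r) = \<phi> r). of_int (sign p) * ?W \<phi>)"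
    by (simp add: Phi_def f sum_distrib_left)
  also have "\<dots> = (\<Sum>\<phi>\<in>?S \<rightarrow>\<^sub>E ?I.
      \<Sum>p | p \<in> {p. p permutes ?S} \<and> (\<forall>r\<in>?S. \<phi> (p r) = \<phi> r). of_int (sign p) * ?W \<phi>)"
    using fin by (subst sum.swap_restrict) (auto intro: finite_permutations)
  also have "\<dots> = (\<Sum>\<phi>\<in>?S \<rightarrow>\<^sub>E ?I. 0)"
  proof (rule sum.cong[OF refl])
    fix \<phi> assume \<phi>: "\<phi> \<in> ?S \<rightarrow>\<^sub>E ?I"
    \<comment> \<open>Pigeonhole: \<open>\<phi>\<close> maps \<open>k\<close> points to fewer than
      \<open>k\<close> indices. The weight depends on \<open>\<phi>\<close> alone, so it factors out
      and leaves a sum of signs over the stabilizer.\<close>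
    have "\<not> inj_on \<phi> ?S"
    proof
      assume "inj_on \<phi> ?S"
      then have "card ?S \<le> card ?I" using \<phi> by (intro card_inj_on_le[of \<phi>]) auto
      then show False using M xs by simp
    qed
    then obtain i j where ij: "i \<in> ?S" "j \<in> ?S" "i \<noteq> j" "\<phi> i = \<phi> j"
      by (auto simp: inj_on_def)
    show "(\<Sum>p | p \<in> {p. p permutes ?S} \<and> (\<forall>r\<in>?S. \<phi> (p r) = \<phi> r). of_int (sign p) * ?W \<phi>) = 0"
      using sum_sign_stabilizer[OF _ ij] by (simp flip: sum_distrib_right)
  qed
  finally show ?thesis by simp
qed

section \<open>The cycle polynomial and its roots\<close>

definition delta :: "'a set \<Rightarrow> 'a \<Rightarrow> 'a \<Rightarrow> complex" where
  "delta X x = (\<lambda>y\<in>X. if y = x then 1 else 0)"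

lemma delta_in_CX [simp]: "delta X x \<in> CX X"
  by (simp add: delta_def)

lemma eval_map_delta:
  assumes "x \<in> X" "set_mset M \<subseteq> X"
  shows "eval_map X M (delta X x) = of_nat (count M x)"
proof -
  have "(\<Sum>y\<in>#M. delta X x y) = of_nat (count M x)"
    using assms(2) by (induction M) (use assms(1) in \<open>auto simp: delta_def\<close>)
  then show ?thesis by (simp add: eval_map_def)
qed

text \<open>This is the falling factorial \<open>z (z - 1) ... (z - k + 1)\<close>, the generating
  function of the signed Stirling numbers of the first kind.\<close>

definition cycle_poly :: "nat \<Rightarrow> complex poly" where
  "cycle_poly k = (\<Sum>p | p permutes {1..k}. monom (of_int (sign p)) (card (orbit p ` {1..k})))"

text \<open>As \<open>delta X x\<close> is idempotent, each cycle contributes the same factor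
  \<open>f (delta X x)\<close>.\<close>

lemma Phi_delta: "Phi X k f (\<lambda>_. delta X x) = poly (cycle_poly k) (f (delta X x))"
proof -
  have "f_perm X f k p (\<lambda>_. delta X x) = f (delta X x) ^ card (orbit p ` {1..k})"
    if p: "p permutes {1..k}" for p
  proof -
    have "(\<lambda>y\<in>X. \<Prod>r\<in>orbit p s. delta X x y) = delta X x" if "s \<in> {1..k}" for s
    proof -
      have "finite (orbit p s)"
        using permutes_orbit_subset[OF p that] by (rule finite_subset) simp
      \<comment> \<open>Away from \<open>x\<close> the product is a power of 0, which is 0 only for
        a positive exponent.\<close>
      then have "card (orbit p s) > 0" using orbit_nonempty by (simp add: card_gt_0_iff)
      then show ?thesis by (auto simp: delta_def)
    qed
    then have "f_perm X f k p (\<lambda>_. delta X x) = (\<Prod>\<gamma>\<in>orbit p ` {1..k}. f (delta X x))"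
      unfolding f_perm_def by (intro prod.cong) auto
    then show ?thesis by simp
  qed
  then show ?thesis by (simp add: Phi_def cycle_poly_def poly_sum poly_monom)
qed

text \<open>Since \<open>r\<close> and \<open>p r\<close> share an orbit, injectivity of
  \<open>orbit p\<close> forces \<open>p r = r\<close>. Hence only the identity contributes to the
  coefficient of degree \<open>k\<close> in \<open>cycle_poly k\<close>.\<close>

lemma card_orbits_eq_iff:
  assumes p: "p permutes S" and S: "finite S"
  shows "card (orbit p ` S) = card S \<longleftrightarrow> p = id"
proof
  assume "card (orbit p ` S) = card S"
  then have inj: "inj_on (orbit p) S" using S by (simp add: eq_card_imp_inj_on)
  have "p r = r" if "r \<in> S" for r
    using inj that permutation_orbit_step[OF permutes_imp_permutation[OF S p]]
    by (simp add: inj_on_def permutes_in_image[OF p])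
  then show "p = id" using permutes_not_in[OF p] by (auto simp: fun_eq_iff)
next
  assume "p = id"
  then have "orbit p r = {r}" for r by (simp add: orbit_eq_singleton_iff)
  then show "card (orbit p ` S) = card S" by (simp add: card_image)
qed

lemma cycle_poly_degree: "degree (cycle_poly k) \<le> k"
  unfolding cycle_poly_def
proof (rule degree_sum_le)
  fix p assume "p \<in> {p. p permutes {1..k}}"
  show "degree (monom (of_int (sign p) :: complex) (card (orbit p ` {1..k}))) \<le> k"
    using card_image_le[of "{1..k}" "orbit p"] degree_monom_le by (auto intro: order_trans)
qed (simp add: finite_permutations)

lemma cycle_poly_coeff: "coeff (cycle_poly k) k = 1"
proof -
  have "coeff (cycle_poly k) k = (\<Sum>p | p permutes {1..k}. if p = id then 1 else 0)"
    unfolding cycle_poly_def coeff_sum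
  proof (rule sum.cong[OF refl])
    fix p assume "p \<in> {p. p permutes {1..k}}"
    then show "coeff (monom (of_int (sign p) :: complex) (card (orbit p ` {1..k}))) k
        = (if p = id then 1 else 0)"
      using card_orbits_eq_iff[of p "{1..k}"] by (auto simp: sign_id)
  qed
  also have "\<dots> = 1"
    by (simp add: finite_permutations permutes_id)
  finally show ?thesis .
qed

lemma cycle_poly_roots: "{z. poly (cycle_poly k) z = 0} = of_nat ` {..<k}"
proof -
  let ?R = "{z. poly (cycle_poly k) z = 0}"
  have nz: "cycle_poly k \<noteq> 0" using cycle_poly_coeff[of k] by auto
  have "poly (cycle_poly k) (of_nat N) = 0" if "N < k" for N
  proof -
    \<comment> \<open>Over the one-point space \<open>unit\<close>, \<open>N\<close> copies of the
      point give a functional whose value at the indicator is \<open>N\<close>.\<close>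
    let ?M = "replicate_mset N ()"
    have "poly (cycle_poly k) (eval_map UNIV ?M (delta UNIV ())) = 0"
      using Phi_eval_map_eq_0[of ?M UNIV k] that by (simp flip: Phi_delta)
    then show ?thesis by (simp add: eval_map_delta)
  qed
  then have sub: "of_nat ` {..<k} \<subseteq> ?R" by auto
  \<comment> \<open>The degree bound leaves no room for roots beyond the \<open>k\<close> already
    found.\<close>
  have "card ?R \<le> card (of_nat ` {..<k} :: complex set)"
    using card_poly_roots_bound[OF nz] cycle_poly_degree[of k]
    by (simp add: card_image inj_on_of_nat)
  with sub show ?thesis
    using poly_roots_finite[OF nz] by (intro card_seteq[symmetric])
qed

section \<open>Linear functionals and the bijection\<close>

lemma Hom_CX_eq_sum:
  assumes X: "finite X" and f: "f \<in> Hom_CX X" and g: "g \<in> CX X"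
  shows "f g = (\<Sum>x\<in>X. g x * f (delta X x))"
proof -
  have add: "f (\<lambda>x\<in>X. u x + v x) = f u + f v" if "u \<in> CX X" "v \<in> CX X" for u v
    using f that by (auto simp: Hom_CX_def)
  have scale: "f (\<lambda>x\<in>X. c * u x) = c * f u" if "u \<in> CX X" for c u
    using f that by (auto simp: Hom_CX_def)
  \<comment> \<open>Truncating \<open>g\<close> to \<open>A\<close> lets binary additivity add one
    point at a time.\<close>
  have "f (\<lambda>x\<in>X. if x \<in> A then g x else 0) = (\<Sum>x\<in>A. g x * f (delta X x))"
    if "finite A" "A \<subseteq> X" for A
    using that
  proof (induction A)
    case empty
    \<comment> \<open>Scaling by 0 gives the value at the zero function;
      \<open>delta X undefined\<close> is merely some element of \<open>CX X\<close>.\<close>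
    show ?case using scale[of "delta X undefined" 0] by (simp add: restrict_def)
  next
    case (insert x A)
    have "(\<lambda>y\<in>X. if y \<in> insert x A then g y else 0)
        = (\<lambda>y\<in>X. (\<lambda>y\<in>X. g x * delta X x y) y + (\<lambda>y\<in>X. if y \<in> A then g y else 0) y)"
      using insert by (auto simp: delta_def fun_eq_iff)
    then show ?case using insert by (simp only: add scale restrict_in_CX delta_in_CX) simp
  qed
  from this[OF X subset_refl]
  have "f (\<lambda>x\<in>X. if x \<in> X then g x else 0) = (\<Sum>x\<in>X. g x * f (delta X x))" .
  moreover have "(\<lambda>x\<in>X. if x \<in> X then g x else 0) = g"
    using g by (auto simp: CX_def fun_eq_iff PiE_def extensional_def)
  ultimately show ?thesis by simp
qed

lemma image_mset_restrict:
  assumes "set_mset M \<subseteq> X"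
  shows "image_mset (restrict u X) M = image_mset u M"
  using assms by (intro image_mset_cong) auto

lemma eval_map_Hom_CX:
  assumes "set_mset M \<subseteq> X"
  shows "eval_map X M \<in> Hom_CX X"
  using assms
  by (auto simp: Hom_CX_def eval_map_def image_mset_restrict sum_mset.distrib sum_mset_distrib_left)

lemma eval_map_one:
  assumes "set_mset M \<subseteq> X"
  shows "eval_map X M (\<lambda>x\<in>X. 1) = of_nat (size M)"
  using assms by (simp add: eval_map_def image_mset_restrict)

lemma frobenius_hom_eval_map:
  assumes "M \<in> Sym n X"
  shows "frobenius_hom X n (eval_map X M)"
  using assms by (auto simp: frobenius_hom_def Sym_def eval_map_Hom_CX eval_map_one Phi_eval_map_eq_0)

text \<open>The value at \<open>delta X x\<close> recovers the multiplicity of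
  \<open>x\<close>.\<close>

lemma inj_on_eval_map: "inj_on (eval_map X) (Sym n X)"
proof (rule inj_onI)
  fix M N assume M: "M \<in> Sym n X" and N: "N \<in> Sym n X" and eq: "eval_map X M = eval_map X N"
  show "M = N"
  proof (rule multiset_eqI)
    fix x
    show "count M x = count N x"
    proof (cases "x \<in> X")
      case True
      then show ?thesis
        using M N eval_map_delta[of x X M] eval_map_delta[of x X N] eq by (simp add: Sym_def)
    next
      case False
      then have "x \<notin># M" "x \<notin># N" using M N by (auto simp: Sym_def)
      then show ?thesis by (simp add: not_in_iff)
    qed
  qed
qed

lemma frobenius_hom_imp_eval_map:
  assumes X: "finite X" and f: "frobenius_hom X n f"
  shows "f \<in> eval_map X ` Sym n X"
proof -
  have hom: "f \<in> Hom_CX X" and one: "f (\<lambda>x\<in>X. 1) = of_nat n"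
    using f by (auto simp: frobenius_hom_def)
  have "\<exists>m. f (delta X x) = of_nat m" for x
  proof -
    have "poly (cycle_poly (n + 1)) (f (delta X x)) = 0"
      using f by (simp add: frobenius_hom_def flip: Phi_delta)
    then show ?thesis using cycle_poly_roots[of "n + 1"] by auto
  qed
  then obtain m where m: "\<And>x. f (delta X x) = of_nat (m x)" by metis
  \<comment> \<open>By \<open>eval_map_delta\<close> this choice is forced: the multiplicity of
    \<open>x\<close> in a preimage must be \<open>f (delta X x)\<close>.\<close>
  define M where "M = (\<Sum>x\<in>X. replicate_mset (m x) x)"
  have sub: "set_mset M \<subseteq> X"
    using X by (auto simp: M_def set_mset_sum)
  have cnt: "count M x = m x" if "x \<in> X" for x
    using X that by (simp add: M_def count_sum)
  have eq: "eval_map X M g = f g" if "g \<in> CX X" for g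
    using Hom_CX_eq_sum[OF X eval_map_Hom_CX[OF sub] that] Hom_CX_eq_sum[OF X hom that] sub
    by (simp add: eval_map_delta cnt m)
  have "of_nat (size M) = (of_nat n :: complex)"
    using eval_map_one[OF sub] eq[of "\<lambda>x\<in>X. 1"] one by simp
  then have "M \<in> Sym n X" using sub by (simp add: Sym_def)
  moreover have "eval_map X M = f"
    \<comment> \<open>Both functionals are extensional on \<open>CX X\<close>, so agreement there is
      equality.\<close>
    using eq hom by (intro extensionalityI[of _ "CX X"]) (auto simp: Hom_CX_def eval_map_def)
  ultimately show ?thesis by blast
qed

theorem theorem3p1:
  fixes X :: "'a set" and n :: nat
  assumes "finite X"
  shows "bij_betw (eval_map X) (Sym n X) {f. frobenius_hom X n f}"
  using frobenius_hom_imp_eval_map[OF assms] frobenius_hom_eval_map inj_on_eval_map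
  by (auto simp: bij_betw_def)

end
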